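(* Let $\alpha\in\mathbb{N}_0$. The symmetric ultraspherical-type operator $L_{2\alpha+4,x}$ and the Jacobi-type operator $L_{2\alpha+4,x}^{\alpha,\alpha+2}$, both of the same order $2\alpha+4$, are linked to each other via $$L_{2\alpha+4,x}\big[(x+1)y(x)\big]=(x+1)\,L_{2\alpha+4,x}^{\alpha,\alpha+2}y(x)$$ for sufficiently smooth functions $y$ on $-1<x<1$.
   Context: $\mathbb{N}_0=\{0,1,2,\dots\}$; $D_x^i$ is $i$-fold differentiation with respect to $x$. The operators are $$L_{2\alpha+4,x}y(x)=(x^2-1)D_x^{2\alpha+4}\big[(x^2-1)^{\alpha+1}y(x)\big]$$ and, for $\beta>-1$, $$L_{2\alpha+4,x}^{\alpha,\beta}y(x)=\frac{x-1}{(x+1)^{\beta}}D_x^{\alpha+2}\Big\{(x+1)^{\alpha+\beta+2}D_x^{\alpha+2}\big[(x-1)^{\alpha+1}y(x)\big]\Big\},$$ taken here with $\beta=\alpha+2$. *)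

theory Defs
  imports "HOL-Analysis.Analysis"
begin

text \<open>
  All functions are total on the reals; a function on the open interval from \<open>-1\<close> to \<open>1\<close> is
  represented by any extension. Since \<open>deriv\<close> is local and the interval is open, the values of the
  operators below at points of the interval do not depend on the extension.
\<close>

definition ultraspherical_type_op :: "nat \<Rightarrow> (real \<Rightarrow> real) \<Rightarrow> real \<Rightarrow> real" where
  "ultraspherical_type_op \<alpha> y x =
     (x\<^sup>2 - 1) * (deriv ^^ (2 * \<alpha> + 4)) (\<lambda>t. (t\<^sup>2 - 1) ^ (\<alpha> + 1) * y t) x"

text \<open>
  The parameter \<open>\<beta>\<close> is real, with \<open>\<beta> > -1\<close> in all intended uses. The powers of \<open>x + 1\<close> are
  therefore written with \<open>powr\<close>, which is the usual power because \<open>x + 1 > 0\<close> on the interval;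
  the base \<open>x - 1\<close> is negative there, and its exponent is a natural number.
\<close>

definition jacobi_type_op :: "nat \<Rightarrow> real \<Rightarrow> (real \<Rightarrow> real) \<Rightarrow> real \<Rightarrow> real" where
  "jacobi_type_op \<alpha> \<beta> y x =
     (x - 1) / (x + 1) powr \<beta> *
       (deriv ^^ (\<alpha> + 2))
         (\<lambda>t. (t + 1) powr (real \<alpha> + \<beta> + 2) *
            (deriv ^^ (\<alpha> + 2)) (\<lambda>s. (s - 1) ^ (\<alpha> + 1) * y s) t) x"

text \<open>
  \<open>n\<close>-fold differentiability on an open set: each derivative of order below \<open>n\<close> exists and is
  itself differentiable there. Continuity of the \<open>n\<close>-th derivative is not required.
\<close>

definition times_differentiable_on :: "nat \<Rightarrow> (real \<Rightarrow> real) \<Rightarrow> real set \<Rightarrow> bool" where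
  "times_differentiable_on n f S \<longleftrightarrow> (\<forall>k<n. ((deriv ^^ k) f) differentiable_on S)"

end

theory Submission
  imports Defs
begin

text \<open>
  Put \<open>n = \<alpha> + 2\<close> and \<open>f t = (t - 1) ^ (n - 1) * y t\<close>. Since
  \<open>(t\<^sup>2 - 1) ^ (n - 1) * (t + 1) = (t + 1) ^ n * (t - 1) ^ (n - 1)\<close>, the extra factor \<open>t + 1\<close> of
  the claim completes the power of \<open>t + 1\<close> on the ultraspherical side, and with \<open>\<beta> = n\<close> the inner
  weight of the Jacobi side is \<open>(t + 1) ^ (2 * n)\<close>. After the outer factors are cancelled, the
  claim becomes the operator identity, with \<open>u = t + 1\<close>,
  \<open>u ^ n * D ^ (2 * n) (u ^ n * f) = D ^ n (u ^ (2 * n) * D ^ n f)\<close>.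

  This identity says that \<open>u ^ n D ^ n\<close> and \<open>D ^ n u ^ n\<close> commute: both are polynomials in the Euler
  operator \<open>u D\<close>. The proof in \<open>higher_deriv_shifted_power_commute\<close> is more direct. By Leibniz' rule
  both sides are combinations of the terms \<open>u ^ (2 * n - i) * D ^ (2 * n - i) f\<close> with \<open>i \<le> n\<close>, and
  both coefficients equal \<open>(2 * n)! * n! / (i! * (n - i)! * (2 * n - i)!)\<close>. The expansion
  fits the exact smoothness of \<open>y\<close>: every derivative in it has order at most \<open>2 * n\<close>.
\<close>

lemma times_differentiable_on_imp_has_real_derivative:
  assumes "times_differentiable_on n f S" and "open S" and "k < n" and "x \<in> S"
  shows "((deriv ^^ k) f has_real_derivative (deriv ^^ Suc k) f x) (at x)"
  using assms
  by (auto simp: times_differentiable_on_def differentiable_on_eq_differentiable_at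
      DERIV_deriv_iff_real_differentiable)

lemma times_differentiable_on_higher_deriv:
  assumes "times_differentiable_on (m + n) f S"
  shows "times_differentiable_on m ((deriv ^^ n) f) S"
  using assms unfolding times_differentiable_on_def
  by (metis add_less_cancel_right comp_apply funpow_add)

text \<open>
  The induction step of Leibniz' rule, in a pointwise form that yields both the value of the next
  derivative of a product and the differentiability of the current one. The two halves of the
  product rule combine by Pascal's identity.
\<close>
lemma has_real_derivative_leibniz_sum:
  fixes f g :: "real \<Rightarrow> real"
  assumes "\<And>i. i \<le> k \<Longrightarrow> ((deriv ^^ i) f has_real_derivative (deriv ^^ Suc i) f x) (at x)"
    and "\<And>i. i \<le> k \<Longrightarrow> ((deriv ^^ i) g has_real_derivative (deriv ^^ Suc i) g x) (at x)"
  shows "((\<lambda>t. \<Sum>i\<le>k. real (k choose i) * ((deriv ^^ i) f t * (deriv ^^ (k - i)) g t))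
    has_real_derivative
      (\<Sum>i\<le>Suc k. real (Suc k choose i) * ((deriv ^^ i) f x * (deriv ^^ (Suc k - i)) g x))) (at x)"
proof -
  define F where "F = (\<lambda>i. (deriv ^^ i) f x)"
  define G where "G = (\<lambda>i. (deriv ^^ i) g x)"
  have "((\<lambda>t. \<Sum>i\<le>k. real (k choose i) * ((deriv ^^ i) f t * (deriv ^^ (k - i)) g t))
    has_real_derivative
      (\<Sum>i\<le>k. real (k choose i) * (F (Suc i) * G (k - i) + G (Suc (k - i)) * F i))) (at x)"
    unfolding F_def G_def
    by (intro DERIV_sum DERIV_cmult DERIV_mult assms) auto
  also have "(\<Sum>i\<le>k. real (k choose i) * (F (Suc i) * G (k - i) + G (Suc (k - i)) * F i))
    = (\<Sum>i\<le>k. real (k choose i) * (F (Suc i) * G (k - i)))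
      + (\<Sum>i\<le>k. real (k choose i) * (F i * G (Suc k - i)))"
    by (simp add: sum.distrib[symmetric] algebra_simps Suc_diff_le)
  also have "(\<Sum>i\<le>k. real (k choose i) * (F i * G (Suc k - i)))
    = (\<Sum>i\<le>Suc k. real (k choose i) * (F i * G (Suc k - i)))"
    by simp
  also have "\<dots> = F 0 * G (Suc k) + (\<Sum>i\<le>k. real (k choose Suc i) * (F (Suc i) * G (k - i)))"
    by (subst sum.atMost_Suc_shift) simp
  also have "(\<Sum>i\<le>k. real (k choose i) * (F (Suc i) * G (k - i))) + \<dots>
    = (\<Sum>i\<le>Suc k. real (Suc k choose i) * (F i * G (Suc k - i)))"
    by (subst sum.atMost_Suc_shift) (simp add: sum.distrib[symmetric] algebra_simps)
  finally show ?thesis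
    by (simp only: F_def G_def)
qed

text \<open>
  Differentiating the formula for order \<open>k\<close> at a point requires it in a neighbourhood of that
  point, since \<open>deriv\<close> is determined by the germ of its argument; hence the open set \<open>S\<close>.
\<close>
lemma higher_deriv_mult_leibniz:
  fixes f g :: "real \<Rightarrow> real"
  assumes S: "open S"
    and f: "times_differentiable_on n f S" and g: "times_differentiable_on n g S"
    and "k \<le> n" and "x \<in> S"
  shows "(deriv ^^ k) (\<lambda>t. f t * g t) x =
    (\<Sum>i\<le>k. real (k choose i) * ((deriv ^^ i) f x * (deriv ^^ (k - i)) g x))"
  using assms(4,5)
proof (induction k arbitrary: x)
  case 0
  then show ?case by simp
next
  case (Suc k)
  let ?s = "\<lambda>t. \<Sum>i\<le>k. real (k choose i) * ((deriv ^^ i) f t * (deriv ^^ (k - i)) g t)"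
  have "eventually (\<lambda>t. (deriv ^^ k) (\<lambda>t. f t * g t) t = ?s t) (nhds x)"
    by (rule eventually_mono[OF eventually_nhds_in_open[OF S \<open>x \<in> S\<close>]]) (use Suc in auto)
  then have "(deriv ^^ Suc k) (\<lambda>t. f t * g t) x = deriv ?s x"
    by (simp add: deriv_cong_ev)
  also have "\<dots> = (\<Sum>i\<le>Suc k. real (Suc k choose i) * ((deriv ^^ i) f x * (deriv ^^ (Suc k - i)) g x))"
    using Suc.prems
    by (intro DERIV_imp_deriv has_real_derivative_leibniz_sum
        times_differentiable_on_imp_has_real_derivative[OF f S]
        times_differentiable_on_imp_has_real_derivative[OF g S]) auto
  finally show ?case .
qed

lemma times_differentiable_on_mult:
  fixes f g :: "real \<Rightarrow> real"
  assumes S: "open S"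
    and f: "times_differentiable_on n f S" and g: "times_differentiable_on n g S"
  shows "times_differentiable_on n (\<lambda>t. f t * g t) S"
  unfolding times_differentiable_on_def
proof (intro allI impI)
  fix k assume k: "k < n"
  let ?s = "\<lambda>t. \<Sum>i\<le>k. real (k choose i) * ((deriv ^^ i) f t * (deriv ^^ (k - i)) g t)"
  have "?s differentiable_on S"
    unfolding differentiable_on_eq_differentiable_at[OF S]
  proof
    fix x assume "x \<in> S"
    have "(?s has_real_derivative
        (\<Sum>i\<le>Suc k. real (Suc k choose i) * ((deriv ^^ i) f x * (deriv ^^ (Suc k - i)) g x))) (at x)"
      using k \<open>x \<in> S\<close>
      by (intro has_real_derivative_leibniz_sum
          times_differentiable_on_imp_has_real_derivative[OF f S]
          times_differentiable_on_imp_has_real_derivative[OF g S]) auto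
    then show "?s differentiable at x"
      unfolding real_differentiable_def by blast
  qed
  moreover have "(deriv ^^ k) (\<lambda>t. f t * g t) x = ?s x" if "x \<in> S" for x
    by (rule higher_deriv_mult_leibniz[OF S f g _ that]) (use k in simp)
  ultimately show "(deriv ^^ k) (\<lambda>t. f t * g t) differentiable_on S"
    unfolding differentiable_on_def differentiable_def
    by (metis (no_types, lifting) has_derivative_transform)
qed

lemma higher_deriv_shifted_power:
  fixes c :: real
  shows "(deriv ^^ k) (\<lambda>t. (t + c) ^ m) =
    (\<lambda>t. (if k \<le> m then fact m / fact (m - k) * (t + c) ^ (m - k) else 0))"
proof (induction k)
  case 0
  then show ?case by simp
next
  case (Suc k)
  show ?case
  proof (cases "Suc k \<le> m")
    case True
    then have mk: "m - k = Suc (m - Suc k)" by simp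
    have "deriv (\<lambda>t. fact m / fact (m - k) * (t + c) ^ (m - k)) x
      = fact m / fact (m - Suc k) * (x + c) ^ (m - Suc k)" for x :: real
      unfolding mk fact_Suc power_Suc2[symmetric]
      by (rule DERIV_imp_deriv)
        (auto intro!: derivative_eq_intros simp: divide_simps simp del: power_Suc of_nat_Suc)
    with True Suc show ?thesis by simp
  next
    case False
    then have "k = m \<or> \<not> k \<le> m" by auto
    then show ?thesis using Suc by auto
  qed
qed

lemma times_differentiable_on_shifted_power:
  "times_differentiable_on n (\<lambda>t. (t + c) ^ m) S"
proof -
  have "(\<lambda>t. if P then a * (t + c) ^ j else 0) differentiable_on S" for P a j
    by (cases P) (auto intro!: differentiable_at_imp_differentiable_on derivative_intros)
  then show ?thesis
    by (simp add: times_differentiable_on_def higher_deriv_shifted_power)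
qed

text \<open>
  In both Leibniz expansions, \<open>i\<close> counts the derivatives that fall on the power of \<open>t + c\<close>. On the
  left, the terms with \<open>i > n\<close> vanish, because they differentiate a polynomial of degree \<open>n\<close> too
  often; what remains matches the right-hand side term by term.
\<close>
lemma higher_deriv_shifted_power_commute:
  fixes f :: "real \<Rightarrow> real"
  assumes S: "open S" and f: "times_differentiable_on (2 * n) f S" and x: "x \<in> S"
  shows "(x + c) ^ n * (deriv ^^ (2 * n)) (\<lambda>t. (t + c) ^ n * f t) x =
    (deriv ^^ n) (\<lambda>t. (t + c) ^ (2 * n) * (deriv ^^ n) f t) x"
proof -
  have coeff: "real (2 * n choose i) * (fact n / fact (n - i)) =
      real (n choose i) * (fact (2 * n) / fact (2 * n - i))" if "i \<le> n" for i
    using that by (simp add: binomial_fact mult_ac)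
  have "(x + c) ^ n * (deriv ^^ (2 * n)) (\<lambda>t. (t + c) ^ n * f t) x
    = (\<Sum>i\<le>2 * n. (x + c) ^ n * (real (2 * n choose i) *
        ((if i \<le> n then fact n / fact (n - i) * (x + c) ^ (n - i) else 0) * (deriv ^^ (2 * n - i)) f x)))"
    by (subst higher_deriv_mult_leibniz[OF S times_differentiable_on_shifted_power f order.refl x])
      (simp add: higher_deriv_shifted_power sum_distrib_left)
  also have "\<dots> = (\<Sum>i\<le>n. (x + c) ^ n * (real (2 * n choose i) *
        (fact n / fact (n - i) * (x + c) ^ (n - i) * (deriv ^^ (2 * n - i)) f x)))"
    by (rule sum.mono_neutral_cong_right) auto
  also have "\<dots> = (\<Sum>i\<le>n. real (n choose i) *
        (fact (2 * n) / fact (2 * n - i) * (x + c) ^ (2 * n - i) * (deriv ^^ (n - i)) ((deriv ^^ n) f) x))"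
  proof (rule sum.cong[OF refl])
    fix i assume "i \<in> {..n}"
    then have i: "i \<le> n" by simp
    have p: "(x + c) ^ n * (x + c) ^ (n - i) = (x + c) ^ (2 * n - i)"
      using i by (simp add: mult_2 flip: power_add)
    have d: "(deriv ^^ (n - i)) ((deriv ^^ n) f) = (deriv ^^ (2 * n - i)) f"
    proof -
      have "2 * n - i = (n - i) + n" using i by simp
      then show ?thesis by (simp add: funpow_add)
    qed
    have "(x + c) ^ n * (real (2 * n choose i) *
        (fact n / fact (n - i) * (x + c) ^ (n - i) * (deriv ^^ (2 * n - i)) f x))
      = (real (2 * n choose i) * (fact n / fact (n - i))) *
        ((x + c) ^ n * (x + c) ^ (n - i)) * (deriv ^^ (2 * n - i)) f x"
      by (simp only: ac_simps)
    then show "(x + c) ^ n * (real (2 * n choose i) *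
        (fact n / fact (n - i) * (x + c) ^ (n - i) * (deriv ^^ (2 * n - i)) f x))
      = real (n choose i) *
        (fact (2 * n) / fact (2 * n - i) * (x + c) ^ (2 * n - i) * (deriv ^^ (n - i)) ((deriv ^^ n) f) x)"
      unfolding d p coeff[OF i] by (simp only: ac_simps)
  qed
  also have "\<dots> = (deriv ^^ n) (\<lambda>t. (t + c) ^ (2 * n) * (deriv ^^ n) f t) x"
  proof -
    have "times_differentiable_on n ((deriv ^^ n) f) S"
      using f by (intro times_differentiable_on_higher_deriv) (simp add: mult_2)
    from higher_deriv_mult_leibniz[OF S times_differentiable_on_shifted_power this order.refl x]
    show ?thesis by (simp add: higher_deriv_shifted_power)
  qed
  finally show ?thesis .
qed

theorem theorem6p1:
  fixes \<alpha> :: nat and y :: "real \<Rightarrow> real" and x :: real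
  assumes "times_differentiable_on (2 * \<alpha> + 4) y {-1<..<1}"
    and "x \<in> {-1<..<1}"
  shows "ultraspherical_type_op \<alpha> (\<lambda>t. (t + 1) * y t) x =
         (x + 1) * jacobi_type_op \<alpha> (real \<alpha> + 2) y x"
proof -
  define n where "n = \<alpha> + 2"
  define f where "f = (\<lambda>s. (s - 1) ^ (\<alpha> + 1) * y s)"
  let ?S = "{-1<..<1::real}"
  have order: "2 * n = 2 * \<alpha> + 4" by (simp add: n_def)
  (* The base is written as a sum, so that the lemma on shifted powers applies with shift -1. *)
  have "times_differentiable_on (2 * n) (\<lambda>s. (s + - 1) ^ (\<alpha> + 1) * y s) ?S"
    using assms(1) unfolding order[symmetric]
    by (intro times_differentiable_on_mult times_differentiable_on_shifted_power) simp_all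
  then have f: "times_differentiable_on (2 * n) f ?S"
    by (simp add: f_def)
  have pos: "x + 1 > 0" using assms(2) by simp

  have "(\<lambda>t. (t\<^sup>2 - 1) ^ (\<alpha> + 1) * ((t + 1) * y t)) = (\<lambda>t. (t + 1) ^ n * f t)"
  proof
    fix t :: real
    have "t\<^sup>2 - 1 = (t + 1) * (t - 1)" by (simp add: power2_eq_square algebra_simps)
    then show "(t\<^sup>2 - 1) ^ (\<alpha> + 1) * ((t + 1) * y t) = (t + 1) ^ n * f t"
      by (simp add: n_def f_def power_mult_distrib)
  qed
  then have lhs: "ultraspherical_type_op \<alpha> (\<lambda>t. (t + 1) * y t) x =
      (x\<^sup>2 - 1) * (deriv ^^ (2 * n)) (\<lambda>t. (t + 1) ^ n * f t) x"
    by (simp only: ultraspherical_type_op_def order)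

  have exps: "real \<alpha> + 2 = real n" "real \<alpha> + real n + 2 = real (2 * n)"
    by (simp_all add: n_def)
  have "(deriv ^^ n) (\<lambda>t. (t + 1) powr real (2 * n) * (deriv ^^ n) f t) x =
      (deriv ^^ n) (\<lambda>t. (t + 1) ^ (2 * n) * (deriv ^^ n) f t) x"
  proof (rule higher_deriv_cong_ev[OF _ refl])
    show "eventually (\<lambda>t. (t + 1) powr real (2 * n) * (deriv ^^ n) f t =
        (t + 1) ^ (2 * n) * (deriv ^^ n) f t) (nhds x)"
      by (rule eventually_mono[OF eventually_nhds_in_open[OF open_greaterThanLessThan assms(2)]])
        (auto simp: powr_realpow simp del: of_nat_mult)
  qed
  also have "\<dots> = (x + 1) ^ n * (deriv ^^ (2 * n)) (\<lambda>t. (t + 1) ^ n * f t) x"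
    using higher_deriv_shifted_power_commute[OF _ f assms(2)] by simp
  finally have "jacobi_type_op \<alpha> (real \<alpha> + 2) y x =
      (x - 1) / (x + 1) ^ n * ((x + 1) ^ n * (deriv ^^ (2 * n)) (\<lambda>t. (t + 1) ^ n * f t) x)"
    unfolding jacobi_type_op_def exps f_def[symmetric] n_def[symmetric]
    using pos by (simp add: powr_realpow)
  also have "\<dots> = (x - 1) * (deriv ^^ (2 * n)) (\<lambda>t. (t + 1) ^ n * f t) x"
    using pos by simp
  finally have jac: "jacobi_type_op \<alpha> (real \<alpha> + 2) y x =
      (x - 1) * (deriv ^^ (2 * n)) (\<lambda>t. (t + 1) ^ n * f t) x" .
  have "(x + 1) * jacobi_type_op \<alpha> (real \<alpha> + 2) y x =
      (x\<^sup>2 - 1) * (deriv ^^ (2 * n)) (\<lambda>t. (t + 1) ^ n * f t) x"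
    unfolding jac by (simp add: power2_eq_square algebra_simps)
  with lhs show ?thesis by simp
qed

end
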